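(* Let $n\in\mathbb{N}$ with $n\ge 1$ and $1\le p<\infty$. Let $\mathcal{N}$ be the set of all functions $\mathbb{R}^n\to\mathbb{R}$ represented by a ReLU network with depth 3 (equivalently, with 2 hidden layers). Then $\mathcal{N}$ is a universal approximator in $L^p(\mathbb{R}^n)$, i.e. $\overline{\mathcal{N}\cap L^p(\mathbb{R}^n)}=L^p(\mathbb{R}^n)$, where the closure is taken in $L^p(\mathbb{R}^n)$.
   Context: $\mathrm{ReLU}(x)=\max(x,0)$ for $x\in\mathbb{R}$, applied coordinatewise to vectors. A function $f:\mathbb{R}^n\to\mathbb{R}$ is represented by a ReLU network with depth 3 (two hidden layers, of arbitrary finite widths) if there are integers $m_1,m_2\ge1$ and affine maps $A_1:\mathbb{R}^n\to\mathbb{R}^{m_1}$, $A_2:\mathbb{R}^{m_1}\to\mathbb{R}^{m_2}$, $A_3:\mathbb{R}^{m_2}\to\mathbb{R}$ such that $f=A_3\circ\mathrm{ReLU}\circ A_2\circ\mathrm{ReLU}\circ A_1$. $L^p(\mathbb{R}^n)$ is with respect to Lebesgue measure and consists of real-valued functions. *)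

theory Defs
  imports "HOL-Analysis.Analysis"
begin

section \<open>The space \<open>L\<^sup>p\<close>\<close>

definition Lp_fun :: "'a measure \<Rightarrow> real \<Rightarrow> ('a \<Rightarrow> real) set" where
  "Lp_fun M p = {f \<in> borel_measurable M. integrable M (\<lambda>x. \<bar>f x\<bar> powr p)}"

definition Lp_norm :: "'a measure \<Rightarrow> real \<Rightarrow> ('a \<Rightarrow> real) \<Rightarrow> real" where
  "Lp_norm M p f = (LINT x|M. \<bar>f x\<bar> powr p) powr (1 / p)"

text \<open>The points of \<open>L\<^sup>p\<close> are the classes of functions modulo equality almost everywhere.\<close>

definition Lp_rel :: "'a measure \<Rightarrow> real \<Rightarrow> ('a \<Rightarrow> real) rel" where
  "Lp_rel M p = {(f, g). f \<in> Lp_fun M p \<and> g \<in> Lp_fun M p \<and> (AE x in M. f x = g x)}"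

definition Lp_class :: "'a measure \<Rightarrow> real \<Rightarrow> ('a \<Rightarrow> real) \<Rightarrow> ('a \<Rightarrow> real) set" where
  "Lp_class M p f = Lp_rel M p `` {f}"

definition Lp_space :: "'a measure \<Rightarrow> real \<Rightarrow> ('a \<Rightarrow> real) set set" where
  "Lp_space M p = Lp_fun M p // Lp_rel M p"

text \<open>The choice of representatives is immaterial, see \<open>Lp_dist_class\<close> below.\<close>

definition Lp_dist :: "'a measure \<Rightarrow> real \<Rightarrow> ('a \<Rightarrow> real) set \<Rightarrow> ('a \<Rightarrow> real) set \<Rightarrow> real" where
  "Lp_dist M p F G = Lp_norm M p (\<lambda>x. (SOME f. f \<in> F) x - (SOME g. g \<in> G) x)"

definition Lp_topology :: "'a measure \<Rightarrow> real \<Rightarrow> ('a \<Rightarrow> real) set topology" where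
  "Lp_topology M p = Metric_space.mtopology (Lp_space M p) (Lp_dist M p)"

lemma convex_powr_nonneg:
  fixes p s t u v :: real
  assumes p: "1 \<le> p" and "0 \<le> s" "0 \<le> t" "0 \<le> u" "0 \<le> v" and uv: "u + v = 1"
  shows "(u * s + v * t) powr p \<le> u * s powr p + v * t powr p"
proof -
  have *: "(w * r) powr p \<le> w * r powr p" if "0 \<le> w" "w \<le> 1" "0 \<le> r" for w r :: real
  proof -
    have "w powr p \<le> w"
      using powr_mono'[of 1 p w] p that by simp
    then show ?thesis
      using that by (simp add: powr_mult mult_right_mono)
  qed
  consider "s = 0" | "t = 0" | "s > 0" "t > 0"
    using assms by linarith
  then show ?thesis
  proof cases
    case 3
    then show ?thesis
      using powr_convex[OF p] assms unfolding convex_on_def by auto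
  qed (use * assms in auto)
qed

lemma Lp_fun_cong_AE:
  assumes "f \<in> Lp_fun M p" "g \<in> borel_measurable M" "AE x in M. f x = g x"
  shows "g \<in> Lp_fun M p"
proof -
  have m: "f \<in> borel_measurable M" "integrable M (\<lambda>x. \<bar>f x\<bar> powr p)"
    using assms by (auto simp: Lp_fun_def)
  have "integrable M (\<lambda>x. \<bar>g x\<bar> powr p)"
    by (rule integrable_cong_AE_imp[OF m(2)]) (use assms in auto)
  then show ?thesis using assms by (simp add: Lp_fun_def)
qed

lemma Lp_norm_nonneg: "0 \<le> Lp_norm M p f"
  by (simp add: Lp_norm_def)

lemma Lp_norm_powr:
  assumes "1 \<le> p"
  shows "Lp_norm M p f powr p = (LINT x|M. \<bar>f x\<bar> powr p)"
  using assms by (simp add: Lp_norm_def powr_powr)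

lemma Lp_norm_cong_AE:
  assumes "f \<in> borel_measurable M" "g \<in> borel_measurable M" "AE x in M. f x = g x"
  shows "Lp_norm M p f = Lp_norm M p g"
proof -
  have "(LINT x|M. \<bar>f x\<bar> powr p) = (LINT x|M. \<bar>g x\<bar> powr p)"
    by (rule integral_cong_AE) (use assms in auto)
  then show ?thesis by (simp add: Lp_norm_def)
qed

lemma Lp_norm_eq_0_iff:
  assumes "1 \<le> p" "f \<in> Lp_fun M p"
  shows "Lp_norm M p f = 0 \<longleftrightarrow> (AE x in M. f x = 0)"
proof -
  have "Lp_norm M p f = 0 \<longleftrightarrow> (LINT x|M. \<bar>f x\<bar> powr p) = 0"
    by (simp add: Lp_norm_def)
  also have "\<dots> \<longleftrightarrow> (AE x in M. \<bar>f x\<bar> powr p = 0)"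
    using assms by (intro integral_nonneg_eq_0_iff_AE) (auto simp: Lp_fun_def)
  finally show ?thesis by simp
qed

lemma Lp_fun_uminus: "f \<in> Lp_fun M p \<Longrightarrow> (\<lambda>x. - f x) \<in> Lp_fun M p"
  by (simp add: Lp_fun_def)

lemma Minkowski_pos:
  assumes p: "1 \<le> p" and f: "f \<in> Lp_fun M p" and g: "g \<in> Lp_fun M p"
    and a: "0 < a" "Lp_norm M p f \<le> a" and b: "0 < b" "Lp_norm M p g \<le> b"
  shows "(\<lambda>x. f x + g x) \<in> Lp_fun M p" "Lp_norm M p (\<lambda>x. f x + g x) \<le> a + b"
proof -
  have m[measurable]: "f \<in> borel_measurable M" "g \<in> borel_measurable M"
    and i: "integrable M (\<lambda>x. \<bar>f x\<bar> powr p)" "integrable M (\<lambda>x. \<bar>g x\<bar> powr p)"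
    using f g by (auto simp: Lp_fun_def)
  define B where "B x = (a + b) powr p *
      (a / (a + b) * (\<bar>f x\<bar> powr p / a powr p) + b / (a + b) * (\<bar>g x\<bar> powr p / b powr p))" for x
  have iB: "integrable M B"
    unfolding B_def using i by auto
  have le: "\<bar>f x + g x\<bar> powr p \<le> B x" for x
  proof -
    have "\<bar>f x + g x\<bar> powr p \<le> (\<bar>f x\<bar> + \<bar>g x\<bar>) powr p"
      using p by (intro powr_mono2) auto
    also have "\<bar>f x\<bar> + \<bar>g x\<bar> = (a + b) * (a / (a + b) * (\<bar>f x\<bar> / a) + b / (a + b) * (\<bar>g x\<bar> / b))"
      using a b by (simp add: distrib_left)
    also have "\<dots> powr p = (a + b) powr p *
        (a / (a + b) * (\<bar>f x\<bar> / a) + b / (a + b) * (\<bar>g x\<bar> / b)) powr p"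
      using a b by (intro powr_mult)
    also have "\<dots> \<le> (a + b) powr p *
        (a / (a + b) * (\<bar>f x\<bar> / a) powr p + b / (a + b) * (\<bar>g x\<bar> / b) powr p)"
      using a b p by (intro mult_left_mono convex_powr_nonneg) (auto simp: add_divide_distrib[symmetric])
    also have "\<dots> = B x"
      using a b by (simp add: B_def powr_divide)
    finally show ?thesis .
  qed
  have i3: "integrable M (\<lambda>x. \<bar>f x + g x\<bar> powr p)"
    by (rule Bochner_Integration.integrable_bound[OF iB]) (use le in \<open>auto intro!: AE_I2 order_trans[OF _ abs_ge_self]\<close>)
  then show "(\<lambda>x. f x + g x) \<in> Lp_fun M p"
    by (simp add: Lp_fun_def)
  have F: "(LINT x|M. \<bar>f x\<bar> powr p) \<le> a powr p"
    unfolding Lp_norm_powr[OF p, symmetric] using a p by (intro powr_mono2) (auto simp: Lp_norm_nonneg)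
  have G: "(LINT x|M. \<bar>g x\<bar> powr p) \<le> b powr p"
    unfolding Lp_norm_powr[OF p, symmetric] using b p by (intro powr_mono2) (auto simp: Lp_norm_nonneg)
  have "(LINT x|M. \<bar>f x + g x\<bar> powr p) \<le> (LINT x|M. B x)"
    using le by (intro integral_mono i3 iB)
  also have "\<dots> = (a + b) powr p * (a / (a + b) * ((LINT x|M. \<bar>f x\<bar> powr p) / a powr p)
      + b / (a + b) * ((LINT x|M. \<bar>g x\<bar> powr p) / b powr p))"
    unfolding B_def using i by simp
  also have "\<dots> \<le> (a + b) powr p * (a / (a + b) * 1 + b / (a + b) * 1)"
    using a b F G by (intro mult_left_mono add_mono) auto
  also have "\<dots> = (a + b) powr p"
    using a b by (simp add: add_divide_distrib[symmetric])
  finally have "(LINT x|M. \<bar>f x + g x\<bar> powr p) powr (1/p) \<le> ((a + b) powr p) powr (1/p)"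
    using p by (intro powr_mono2) auto
  then show "Lp_norm M p (\<lambda>x. f x + g x) \<le> a + b"
    using a b p by (simp add: Lp_norm_def powr_powr)
qed

lemma Lp_fun_add:
  assumes "1 \<le> p" "f \<in> Lp_fun M p" "g \<in> Lp_fun M p"
  shows "(\<lambda>x. f x + g x) \<in> Lp_fun M p"
  using assms Minkowski_pos(1)[of p f M g "Lp_norm M p f + 1" "Lp_norm M p g + 1"]
    Lp_norm_nonneg[of M p f] Lp_norm_nonneg[of M p g] by simp

lemma Lp_fun_diff:
  assumes "1 \<le> p" "f \<in> Lp_fun M p" "g \<in> Lp_fun M p"
  shows "(\<lambda>x. f x - g x) \<in> Lp_fun M p"
  using Lp_fun_add[OF assms(1,2) Lp_fun_uminus[OF assms(3)]] by simp

lemma Lp_norm_triangle: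
  assumes "1 \<le> p" "f \<in> Lp_fun M p" "g \<in> Lp_fun M p"
  shows "Lp_norm M p (\<lambda>x. f x + g x) \<le> Lp_norm M p f + Lp_norm M p g"
proof (rule field_le_epsilon)
  fix e :: real assume "e > 0"
  then show "Lp_norm M p (\<lambda>x. f x + g x) \<le> Lp_norm M p f + Lp_norm M p g + e"
    using assms Minkowski_pos(2)[of p f M g "Lp_norm M p f + e/2" "Lp_norm M p g + e/2"]
      Lp_norm_nonneg[of M p f] Lp_norm_nonneg[of M p g] by simp
qed

lemma equiv_Lp_rel: "equiv (Lp_fun M p) (Lp_rel M p)"
proof (rule equivI)
  show "trans (Lp_rel M p)"
  proof (rule transI)
    fix f g h assume "(f, g) \<in> Lp_rel M p" "(g, h) \<in> Lp_rel M p"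
    then show "(f, h) \<in> Lp_rel M p"
      by (auto simp: Lp_rel_def elim: AE_mp)
  qed
qed (auto simp: Lp_rel_def refl_on_def sym_def eq_commute)

lemma Lp_class_in_space: "f \<in> Lp_fun M p \<Longrightarrow> Lp_class M p f \<in> Lp_space M p"
  by (simp add: Lp_class_def Lp_space_def quotientI)

lemma Lp_spaceE:
  assumes "F \<in> Lp_space M p"
  obtains f where "f \<in> Lp_fun M p" "F = Lp_class M p f"
  using assms by (auto simp: Lp_class_def Lp_space_def elim: quotientE)

lemma Lp_class_eq_iff:
  assumes "f \<in> Lp_fun M p" "g \<in> Lp_fun M p"
  shows "Lp_class M p f = Lp_class M p g \<longleftrightarrow> (AE x in M. f x = g x)"
  using eq_equiv_class_iff[OF equiv_Lp_rel assms] assms by (simp add: Lp_class_def Lp_rel_def)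

lemma Lp_class_some:
  assumes "f \<in> Lp_fun M p"
  shows "(SOME g. g \<in> Lp_class M p f) \<in> Lp_fun M p"
    "AE x in M. f x = (SOME g. g \<in> Lp_class M p f) x"
proof -
  have "f \<in> Lp_class M p f"
    using assms by (simp add: Lp_class_def Lp_rel_def)
  then have "(SOME g. g \<in> Lp_class M p f) \<in> Lp_class M p f"
    by (rule someI[where P = "\<lambda>g. g \<in> Lp_class M p f"])
  then show "(SOME g. g \<in> Lp_class M p f) \<in> Lp_fun M p"
    "AE x in M. f x = (SOME g. g \<in> Lp_class M p f) x"
    by (auto simp: Lp_class_def Lp_rel_def)
qed

lemma Lp_dist_class:
  assumes "f \<in> Lp_fun M p" "g \<in> Lp_fun M p"
  shows "Lp_dist M p (Lp_class M p f) (Lp_class M p g) = Lp_norm M p (\<lambda>x. f x - g x)"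
  unfolding Lp_dist_def
proof (rule Lp_norm_cong_AE)
  show "AE x in M. (SOME h. h \<in> Lp_class M p f) x - (SOME h. h \<in> Lp_class M p g) x = f x - g x"
    using Lp_class_some(2)[OF assms(1)] Lp_class_some(2)[OF assms(2)] by eventually_elim simp
qed (use assms Lp_class_some(1)[OF assms(1)] Lp_class_some(1)[OF assms(2)] in
      \<open>auto simp: Lp_fun_def\<close>)

lemma Metric_space_Lp:
  assumes p: "1 \<le> p"
  shows "Metric_space (Lp_space M p) (Lp_dist M p)"
proof
  fix F G H
  show "0 \<le> Lp_dist M p F G"
    by (simp add: Lp_dist_def Lp_norm_nonneg)
  show "Lp_dist M p F G = Lp_dist M p G F"
    by (simp add: Lp_dist_def Lp_norm_def abs_minus_commute)
  assume "F \<in> Lp_space M p" "G \<in> Lp_space M p"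
  then obtain f g where f: "f \<in> Lp_fun M p" "F = Lp_class M p f"
    and g: "g \<in> Lp_fun M p" "G = Lp_class M p g"
    by (metis Lp_spaceE)
  show "Lp_dist M p F G = 0 \<longleftrightarrow> F = G"
    using f g p by (simp add: Lp_dist_class Lp_class_eq_iff Lp_norm_eq_0_iff Lp_fun_diff)
  assume "H \<in> Lp_space M p"
  then obtain h where h: "h \<in> Lp_fun M p" "H = Lp_class M p h"
    by (metis Lp_spaceE)
  show "Lp_dist M p F H \<le> Lp_dist M p F G + Lp_dist M p G H"
    using Lp_norm_triangle[OF p Lp_fun_diff[OF p f(1) g(1)] Lp_fun_diff[OF p g(1) h(1)]] f g h
    by (simp add: Lp_dist_class)
qed


section \<open>ReLU networks\<close>

definition ReLU :: "real \<Rightarrow> real" where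
  "ReLU x = max x 0"

text \<open>
  Since the widths are existentially quantified natural numbers, \<open>\<real>\<^sup>m\<close> for a hidden layer is
  modelled by functions \<open>nat \<Rightarrow> real\<close> of which only the coordinates in \<open>{..<m}\<close> matter. More
  generally, \<open>affine_map I J A\<close> says that, on the coordinates in \<open>J\<close>, \<open>A\<close> is an affine map from
  \<open>\<real>\<^sup>I\<close> to \<open>\<real>\<^sup>J\<close>; the sum in \<open>affine_fun\<close> makes the values outside \<open>I\<close> and \<open>J\<close> irrelevant
  for a composition. The input \<open>x :: real ^ 'n\<close> enters through its coordinate function \<open>($) x\<close>.
\<close>

definition affine_fun :: "'i set \<Rightarrow> (('i \<Rightarrow> real) \<Rightarrow> real) \<Rightarrow> bool" where
  "affine_fun I a \<longleftrightarrow> (\<exists>w b. \<forall>x. a x = (\<Sum>i\<in>I. w i * x i) + b)"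

definition affine_map :: "'i set \<Rightarrow> 'j set \<Rightarrow> (('i \<Rightarrow> real) \<Rightarrow> 'j \<Rightarrow> real) \<Rightarrow> bool" where
  "affine_map I J A \<longleftrightarrow> (\<forall>j\<in>J. affine_fun I (\<lambda>x. A x j))"

definition ReLU_networks_depth3 :: "(real ^ 'n \<Rightarrow> real) set" where
  "ReLU_networks_depth3 =
    {f. \<exists>(m1 :: nat) (m2 :: nat) A1 A2 A3. m1 \<ge> 1 \<and> m2 \<ge> 1 \<and>
        affine_map (UNIV :: 'n set) {..<m1} A1 \<and>
        affine_map {..<m1} {..<m2} A2 \<and>
        affine_fun {..<m2} A3 \<and>
        (\<forall>x. f x = A3 (ReLU \<circ> A2 (ReLU \<circ> A1 (($) x))))}"

end

theory Submission
  imports Defs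
begin

text \<open>
  A trapezoid on the real line is a linear combination of four ReLUs. The second hidden layer turns
  the sum of such trapezoids \<open>t\<^sub>i(x\<^sub>i) \<le> 1\<close> over the coordinates into
  \<open>ReLU (\<Sum>\<^sub>i t\<^sub>i(x\<^sub>i) - (n - 1))\<close>, which vanishes outside a box since some \<open>t\<^sub>i\<close> is nonpositive there,
  and tends to \<open>1\<close> inside the box as the trapezoids become steeper. So the closure of the networks,
  a linear space that is stable under dominated limits, contains the indicator of every box. The
  monotone class argument then gives the indicators of all sets of finite measure, and
  approximation by simple functions gives everything.
\<close>

section \<open>Density in \<open>L\<^sup>p\<close>\<close>

lemma Lp_fun_cmult: "f \<in> Lp_fun M p \<Longrightarrow> (\<lambda>x. c * f x) \<in> Lp_fun M p"
  by (auto simp: Lp_fun_def abs_mult powr_mult)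

lemma Lp_norm_cmult:
  assumes "1 \<le> p"
  shows "Lp_norm M p (\<lambda>x. c * f x) = \<bar>c\<bar> * Lp_norm M p f"
  using assms by (simp add: Lp_norm_def abs_mult powr_mult powr_powr)

lemma Lp_fun_bound:
  assumes p: "1 \<le> p" and w: "w \<in> Lp_fun M p" and f: "f \<in> borel_measurable M"
    and le: "AE x in M. \<bar>f x\<bar> \<le> \<bar>w x\<bar>"
  shows "f \<in> Lp_fun M p"
proof -
  have "integrable M (\<lambda>x. \<bar>f x\<bar> powr p)"
  proof (rule Bochner_Integration.integrable_bound)
    show "AE x in M. norm (\<bar>f x\<bar> powr p) \<le> norm (\<bar>w x\<bar> powr p)"
      using le by eventually_elim (use p in \<open>auto intro!: powr_mono2\<close>)
  qed (use w f in \<open>auto simp: Lp_fun_def\<close>)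
  then show ?thesis using f by (simp add: Lp_fun_def)
qed

lemma indicator_in_Lp_fun:
  assumes "A \<in> fmeasurable M"
  shows "indicator A \<in> Lp_fun M p"
proof -
  have "(\<lambda>x. \<bar>indicator A x :: real\<bar> powr p) = indicator A"
    by (auto simp: indicator_def)
  then show ?thesis
    using assms by (auto simp: Lp_fun_def fmeasurable_def)
qed

text \<open>Dominated convergence for integrals, applied to
  \<open>\<bar>f x - s i x\<bar> powr p\<close>. The bound by \<open>w\<close> passes to the limit,
  so \<open>f\<close> is dominated by \<open>w\<close> as well.\<close>

lemma Lp_dominated_convergence:
  assumes p: "1 \<le> p" and w: "w \<in> Lp_fun M p"
    and s: "\<And>i. s i \<in> borel_measurable M" and f: "f \<in> borel_measurable M"
    and le: "\<And>i. AE x in M. \<bar>s i x\<bar> \<le> \<bar>w x\<bar>"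
    and lim: "AE x in M. (\<lambda>i. s i x) \<longlonglongrightarrow> f x"
  shows "f \<in> Lp_fun M p" "s i \<in> Lp_fun M p" "(\<lambda>i. Lp_norm M p (\<lambda>x. f x - s i x)) \<longlonglongrightarrow> 0"
proof -
  have lef: "AE x in M. \<bar>f x\<bar> \<le> \<bar>w x\<bar>"
  proof -
    have "AE x in M. \<forall>i. \<bar>s i x\<bar> \<le> \<bar>w x\<bar>"
      using le by (simp add: AE_all_countable)
    with lim show ?thesis
      by eventually_elim (auto intro: LIMSEQ_le_const2[OF tendsto_rabs])
  qed
  show fL: "f \<in> Lp_fun M p" and "s i \<in> Lp_fun M p"
    using Lp_fun_bound[OF p w] f s lef le by auto
  \<comment> \<open>The factor 2 comes from bounding \<open>f - s i\<close> by the sum of two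
    functions, each dominated by \<open>w\<close>.\<close>
  have i: "integrable M (\<lambda>x. \<bar>2 * w x\<bar> powr p)"
    using Lp_fun_cmult[OF w, of 2] by (simp add: Lp_fun_def)
  have "(\<lambda>i. LINT x|M. \<bar>f x - s i x\<bar> powr p) \<longlonglongrightarrow> (LINT x|M. 0)"
  proof (rule integral_dominated_convergence[OF _ _ i])
    show "AE x in M. (\<lambda>i. \<bar>f x - s i x\<bar> powr p) \<longlonglongrightarrow> 0"
      using lim
    proof eventually_elim
      case (elim x)
      have "(\<lambda>i. \<bar>f x - s i x\<bar>) \<longlonglongrightarrow> \<bar>f x - f x\<bar>"
        by (intro tendsto_intros elim)
      then show ?case
        using p by (intro tendsto_zero_powrI[where b = p]) auto
    qed
    show "AE x in M. norm (\<bar>f x - s i x\<bar> powr p) \<le> \<bar>2 * w x\<bar> powr p" for i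
      using le[of i] lef by eventually_elim (use p in \<open>auto intro!: powr_mono2\<close>)
  qed (use f s in auto)
  then show "(\<lambda>i. Lp_norm M p (\<lambda>x. f x - s i x)) \<longlonglongrightarrow> 0"
    unfolding Lp_norm_def using p
    by (intro tendsto_zero_powrI[where b = "1 / p"]) auto
qed

text \<open>A monotone class principle for functions. \<open>V\<close> is shown to contain, in turn,
  the indicators of Borel subsets of boxes, those of sets of finite measure, the simple functions in
  \<open>Lp_fun\<close>, and finally every \<open>f\<close> in \<open>Lp_fun\<close>.\<close>

lemma Lp_fun_lebesgue_induct:
  fixes V :: "('a::euclidean_space \<Rightarrow> real) set"
  assumes p: "1 \<le> p"
    and box: "\<And>a b. indicator (box a b) \<in> V"
    and add: "\<And>f g. f \<in> V \<Longrightarrow> g \<in> V \<Longrightarrow> (\<lambda>x. f x + g x) \<in> V"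
    and cmult: "\<And>f c. f \<in> V \<Longrightarrow> (\<lambda>x. c * f x) \<in> V"
    and lim: "\<And>s f w. (\<And>i. s i \<in> V) \<Longrightarrow> w \<in> Lp_fun lebesgue p \<Longrightarrow> f \<in> borel_measurable lebesgue
      \<Longrightarrow> (\<And>i x. \<bar>s i x\<bar> \<le> \<bar>w x\<bar>) \<Longrightarrow> (AE x in lebesgue. (\<lambda>i. s i x) \<longlonglongrightarrow> f x) \<Longrightarrow> f \<in> V"
    and f: "f \<in> Lp_fun lebesgue p"
  shows "f \<in> V"
proof -
  have zero: "(\<lambda>x. 0) \<in> V"
    using cmult[OF box, of 0] by simp
  have sum: "(\<lambda>x. \<Sum>i\<in>I. g i x) \<in> V" if "finite I" "\<And>i. i \<in> I \<Longrightarrow> g i \<in> V" for I and g :: "'i \<Rightarrow> 'a \<Rightarrow> real"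
    using that by (induction I) (auto simp: zero add)
  \<comment> \<open>Everything is cut down to a box, so that complements keep finite measure and the
    indicator of the box serves as the majorant for countable unions.\<close>
  have Int_box: "indicator (A \<inter> box a b) \<in> V" if "A \<in> sets borel" for A and a b :: 'a
  proof -
    have "Int_stable (range (\<lambda>(a, b). box a b :: 'a set))"
      by (auto simp: Int_stable_def box_Int_box)
    moreover have "range (\<lambda>(a, b). box a b :: 'a set) \<subseteq> Pow UNIV"
      by simp
    moreover have "A \<in> sigma_sets UNIV (range (\<lambda>(a, b). box a b :: 'a set))"
      using that by (simp add: borel_eq_box)
    ultimately show ?thesis
    proof (induction arbitrary: a b rule: sigma_sets_induct_disjoint)
      case (basic A)
      then show ?case by (auto simp: box_Int_box box)
    next
      case empty
      show ?case using zero by (simp add: indicator_def[abs_def])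
    next
      case (compl A)
      have "indicator ((UNIV - A) \<inter> box a b) =
          (\<lambda>x. indicator (box a b) x + (-1) * indicator (A \<inter> box a b) x :: real)"
        by (auto simp: indicator_def)
      then show ?case using add[OF box cmult[OF compl.IH]] by metis
    next
      case (union A)
      have sets: "A i \<in> sets borel" for i
        using union(2) by (auto simp: borel_eq_box)
      define B where "B i = A i \<inter> box a b" for i
      \<comment> \<open>Disjointness turns the partial sums, which are in \<open>V\<close> by
        linearity, into indicators of partial unions, which stay below the indicator of the
        box.\<close>
      have *: "(\<Sum>i<k. indicator (B i) x) = (indicator (\<Union>i<k. B i) x :: real)" for k x
        using union(1) by (subst indicator_UN_disjoint)
          (auto simp: B_def disjoint_family_on_def)
      show ?case
      proof (rule lim)
        show "(\<lambda>x. \<Sum>i<k. indicator (B i) x) \<in> V" for k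
          using union.IH by (intro sum) (auto simp: B_def)
        show "indicator (box a b) \<in> Lp_fun lebesgue p"
          by (intro indicator_in_Lp_fun) simp
        show "indicator (\<Union> (range A) \<inter> box a b) \<in> borel_measurable lebesgue"
          using sets by (intro borel_measurable_indicator) (auto intro!: sets.Int sets.countable_UN)
        show "\<bar>\<Sum>i<k. indicator (B i) x\<bar> \<le> \<bar>indicator (box a b) x :: real\<bar>" for k x
          unfolding * by (auto simp: B_def indicator_def)
        have "(\<Union>i. B i) = \<Union> (range A) \<inter> box a b"
          by (auto simp: B_def)
        then have "(\<lambda>k. indicator (\<Union>i<k. B i) x) \<longlonglongrightarrow> (indicator (\<Union> (range A) \<inter> box a b) x :: real)" for x
          by (metis LIMSEQ_indicator_UN)
        then show "AE x in lebesgue. (\<lambda>k. \<Sum>i<k. indicator (B i) x)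
            \<longlonglongrightarrow> (indicator (\<Union> (range A) \<inter> box a b) x :: real)"
          unfolding * by (intro AE_I2)
      qed
    qed
  qed
  have ind: "indicator A \<in> V" if A: "A \<in> lmeasurable" for A
  proof -
    \<comment> \<open>A Lebesgue set is a Borel set up to a part of a Borel null set. The
      approximations below only see \<open>S\<close>, so they converge to the indicator of
      \<open>A\<close> off \<open>N'\<close>; this is where convergence almost everywhere
      enters.\<close>
    obtain S N N' where S: "A = S \<union> N" "N \<subseteq> N'" "N' \<in> null_sets lborel" "S \<in> sets borel"
      using fmeasurableD[OF A] by (auto elim!: sets_completionE)
    show ?thesis
    proof (rule lim)
      \<comment> \<open>Growing cubes exhaust the space, and each truncation of \<open>S\<close> is
        covered by \<open>Int_box\<close>.\<close>
      show "indicator (S \<inter> box (- (real k *\<^sub>R One)) (real k *\<^sub>R One)) \<in> V" for k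
        using Int_box S by auto
      show "indicator A \<in> Lp_fun lebesgue p"
        using A by (rule indicator_in_Lp_fun)
      show "indicator A \<in> borel_measurable lebesgue"
        using A by (auto simp: fmeasurable_def)
      show "\<bar>indicator (S \<inter> box (- (real k *\<^sub>R One)) (real k *\<^sub>R One)) x\<bar> \<le> \<bar>indicator A x :: real\<bar>" for k x
        using S by (auto simp: indicator_def)
      have "AE x in lebesgue. x \<notin> N'"
        using S(3) by (intro AE_not_in) (auto simp: null_sets_completionI)
      then show "AE x in lebesgue. (\<lambda>k. indicator (S \<inter> box (- (real k *\<^sub>R One)) (real k *\<^sub>R One)) x)
          \<longlonglongrightarrow> (indicator A x :: real)"
      proof eventually_elim
        case (elim x)
        obtain K :: nat where K: "norm x < real K"
          using reals_Archimedean2 by blast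
        have "x \<in> box (- (real k *\<^sub>R One)) (real k *\<^sub>R One)" if "k \<ge> K" for k
        proof -
          have "\<bar>x \<bullet> i\<bar> < real k" if "i \<in> Basis" for i
            using Basis_le_norm[OF that, of x] K \<open>k \<ge> K\<close> by linarith
          then show ?thesis
            by (auto simp: mem_box abs_less_iff minus_less_iff)
        qed
        then have "indicator (S \<inter> box (- (real k *\<^sub>R One)) (real k *\<^sub>R One)) x = (indicator A x :: real)"
          if "k \<ge> K" for k
          using that elim S by (auto simp: indicator_def)
        then show ?case
          by (intro tendsto_eventually eventually_sequentiallyI)
      qed
    qed
  qed
  have simple: "s \<in> V" if s: "simple_function lebesgue s" "s \<in> Lp_fun lebesgue p" for s
  proof -
    \<comment> \<open>Chebyshev: on this fibre
      \<open>\<bar>s x\<bar> powr p / \<bar>y\<bar> powr p\<close> equals 1, so the fibre has finite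
      measure. The value 0 is left out because its fibre may have infinite measure.\<close>
    have "indicator (s -` {y}) \<in> V" if "y \<noteq> 0" for y
    proof (rule ind)
      have m: "s -` {y} \<in> sets lebesgue"
        using simple_functionD(2)[OF s(1), of "{y}"] by simp
      have "integrable lebesgue (indicator (s -` {y}) :: 'a \<Rightarrow> real)"
      proof (rule Bochner_Integration.integrable_bound)
        show "integrable lebesgue (\<lambda>x. \<bar>s x\<bar> powr p / \<bar>y\<bar> powr p)"
          using s(2) by (auto simp: Lp_fun_def)
      qed (use m that in \<open>auto simp: indicator_def\<close>)
      then show "s -` {y} \<in> lmeasurable"
        using m by (simp add: lmeasurable_iff_integrable)
    qed
    then have "(\<lambda>x. \<Sum>y\<in>range s - {0}. y * indicator (s -` {y}) x) \<in> V"
      using simple_functionD(1)[OF s(1)] by (intro sum cmult) auto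
    moreover have "(\<Sum>y\<in>range s - {0}. y * indicator (s -` {y}) x) = s x" for x
    proof -
      have "(\<Sum>y\<in>range s - {0}. y * indicator (s -` {y}) x) = (\<Sum>y\<in>range s - {0}. if y = s x then y else 0)"
        by (rule sum.cong) auto
      then show ?thesis
        using simple_functionD(1)[OF s(1)] by simp
    qed
    ultimately show ?thesis by simp
  qed
  \<comment> \<open>The library sequence stays within twice the distance of \<open>f x\<close> from
    a base point; the base point 0 gives the majorant \<open>2 * f x\<close>.\<close>
  obtain s where s: "\<And>i. simple_function lebesgue (s i)"
      "\<And>x. (\<lambda>i. s i x) \<longlonglongrightarrow> f x" "\<And>i x. \<bar>s i x\<bar> \<le> 2 * \<bar>f x\<bar>"
    using borel_measurable_implies_sequence_metric[of f lebesgue 0] f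
    by (auto simp: Lp_fun_def dist_real_def)
  have w: "(\<lambda>x. 2 * f x) \<in> Lp_fun lebesgue p"
    using f by (rule Lp_fun_cmult)
  show ?thesis
  proof (rule lim[OF _ w])
    show "AE x in lebesgue. (\<lambda>i. s i x) \<longlonglongrightarrow> f x"
      using s(2) by simp
    show "s i \<in> V" for i
    proof (rule simple[OF s(1)])
      show "s i \<in> Lp_fun lebesgue p"
        by (rule Lp_fun_bound[OF p w])
          (use s in \<open>auto simp: abs_mult intro: borel_measurable_simple_function\<close>)
    qed
  qed (use s f in \<open>auto simp: abs_mult Lp_fun_def\<close>)
qed

text \<open>The functions that \<open>S\<close> approximates in norm form a linear space that is
  stable under dominated limits, so the induction principle reduces density to indicators of boxes.
  Members of \<open>S\<close> may lie outside \<open>Lp_fun\<close>; the dominating indicator puts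
  the approximants \<open>s k\<close> inside.\<close>

lemma Lp_closure_of_lebesgue:
  fixes S :: "('a::euclidean_space \<Rightarrow> real) set"
  assumes p: "1 \<le> p"
    and add: "\<And>f g. f \<in> S \<Longrightarrow> g \<in> S \<Longrightarrow> (\<lambda>x. f x + g x) \<in> S"
    and cmult: "\<And>f c. f \<in> S \<Longrightarrow> (\<lambda>x. c * f x) \<in> S"
    and box: "\<And>a b. \<exists>s. (\<forall>k. s k \<in> S) \<and> (\<forall>k. s k \<in> borel_measurable lebesgue) \<and>
      (\<forall>k x. \<bar>s k x\<bar> \<le> indicator (box a b) x) \<and> (\<forall>x. (\<lambda>k. s k x) \<longlonglongrightarrow> indicator (box a b) x)"
  shows "Lp_topology lebesgue p closure_of (Lp_class lebesgue p ` (S \<inter> Lp_fun lebesgue p))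
    = Lp_space lebesgue p"
proof -
  let ?L = "Lp_fun (lebesgue :: 'a measure) p"
  let ?n = "Lp_norm (lebesgue :: 'a measure) p"
  define V where "V = {f \<in> ?L. \<forall>e>0. \<exists>g\<in>S \<inter> ?L. ?n (\<lambda>x. f x - g x) < e}"
  have lim0: "f \<in> V" if s: "\<And>i. s i \<in> V" and w: "w \<in> ?L" and f: "f \<in> borel_measurable lebesgue"
    and le: "\<And>i x. \<bar>s i x\<bar> \<le> \<bar>w x\<bar>" and l: "AE x in lebesgue. (\<lambda>i. s i x) \<longlonglongrightarrow> f x" for s f w
  proof -
    have sm: "s i \<in> borel_measurable lebesgue" for i
      using s by (auto simp: V_def Lp_fun_def)
    note dc = Lp_dominated_convergence[OF p w sm f _ l]
    have fL: "f \<in> ?L" and sL: "\<And>i. s i \<in> ?L" and "(\<lambda>i. ?n (\<lambda>x. f x - s i x)) \<longlonglongrightarrow> 0"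
      using dc le by auto
    have "\<exists>g\<in>S \<inter> ?L. ?n (\<lambda>x. f x - g x) < e" if e: "e > 0" for e
    \<comment> \<open>Half of \<open>e\<close> goes to replacing \<open>f\<close> by some
      \<open>s i\<close>, the other half to approximating that \<open>s i\<close> from
      \<open>S\<close>.\<close>
    proof -
      have "eventually (\<lambda>i. ?n (\<lambda>x. f x - s i x) < e / 2) sequentially"
        using order_tendstoD(2)[OF \<open>(\<lambda>i. ?n _) \<longlonglongrightarrow> 0\<close>, of "e / 2"] e by simp
      then obtain i where i: "?n (\<lambda>x. f x - s i x) < e / 2"
        by (auto simp: eventually_sequentially)
      obtain g where g: "g \<in> S \<inter> ?L" "?n (\<lambda>x. s i x - g x) < e / 2"
        using s[of i] e by (auto simp: V_def dest: spec[of _ "e/2"])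
      have "?n (\<lambda>x. (f x - s i x) + (s i x - g x)) \<le> ?n (\<lambda>x. f x - s i x) + ?n (\<lambda>x. s i x - g x)"
        using g fL sL by (intro Lp_norm_triangle p Lp_fun_diff) auto
      then show ?thesis using g i by (intro bexI[of _ g]) auto
    qed
    then show ?thesis using fL by (auto simp: V_def)
  qed
  have norm0: "?n (\<lambda>x. 0) = 0"
    by (simp add: Lp_norm_def)
  have V: "f \<in> V" if "f \<in> ?L" for f
  proof (rule Lp_fun_lebesgue_induct[OF p _ _ _ lim0 that])
    fix a b :: 'a
    obtain s where s: "\<And>k. s k \<in> S" "\<And>k. s k \<in> borel_measurable lebesgue"
        "\<And>k x. \<bar>s k x\<bar> \<le> indicator (box a b) x" "\<And>x. (\<lambda>k. s k x) \<longlonglongrightarrow> indicator (box a b) x"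
      using box[of a b] by blast
    have w: "indicator (box a b) \<in> ?L"
      by (intro indicator_in_Lp_fun) simp
    show "indicator (box a b) \<in> V"
    proof (rule lim0[OF _ w])
      show "(indicator (box a b) :: 'a \<Rightarrow> real) \<in> borel_measurable lebesgue"
        using w by (simp add: Lp_fun_def)
      show "AE x in lebesgue. (\<lambda>k. s k x) \<longlonglongrightarrow> indicator (box a b) x"
        using s(4) by simp
      \<comment> \<open>Each \<open>s k\<close> belongs to \<open>S\<close> and, being dominated, to
        \<open>Lp_fun\<close>; it is its own approximation at distance 0.\<close>
      show "s k \<in> V" for k
        using s Lp_fun_bound[OF p w, of "s k"] by (auto simp: V_def norm0 intro!: bexI[of _ "s k"])
    qed (use s in auto)
  next
    fix f g assume fg: "f \<in> V" "g \<in> V"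
    have "\<exists>h\<in>S \<inter> ?L. ?n (\<lambda>x. (f x + g x) - h x) < e" if e: "e > 0" for e
    proof -
      obtain f' g' where f': "f' \<in> S \<inter> ?L" "?n (\<lambda>x. f x - f' x) < e / 2"
        and g': "g' \<in> S \<inter> ?L" "?n (\<lambda>x. g x - g' x) < e / 2"
        using fg e by (fastforce simp: V_def dest: spec[of _ "e/2"])
      have "?n (\<lambda>x. (f x - f' x) + (g x - g' x)) \<le> ?n (\<lambda>x. f x - f' x) + ?n (\<lambda>x. g x - g' x)"
        using fg f' g' by (intro Lp_norm_triangle p Lp_fun_diff) (auto simp: V_def)
      also have "(\<lambda>x. (f x - f' x) + (g x - g' x)) = (\<lambda>x. (f x + g x) - (f' x + g' x))"
        by auto
      finally show ?thesis
        using f' g' add Lp_fun_add[OF p] by (intro bexI[of _ "\<lambda>x. f' x + g' x"]) auto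
    qed
    then show "(\<lambda>x. f x + g x) \<in> V"
      using fg Lp_fun_add[OF p] by (auto simp: V_def)
  next
    fix f c assume f: "f \<in> V"
    have "\<exists>h\<in>S \<inter> ?L. ?n (\<lambda>x. c * f x - h x) < e" if e: "e > 0" for e
    proof -
      \<comment> \<open>The added 1 keeps the denominator positive when
        \<open>c = 0\<close>.\<close>
      have "e / (\<bar>c\<bar> + 1) > 0" using e by simp
      then obtain g where g: "g \<in> S \<inter> ?L" "?n (\<lambda>x. f x - g x) < e / (\<bar>c\<bar> + 1)"
        using f unfolding V_def by blast
      have "?n (\<lambda>x. c * f x - c * g x) = \<bar>c\<bar> * ?n (\<lambda>x. f x - g x)"
        using Lp_norm_cmult[OF p, of lebesgue c "\<lambda>x. f x - g x"] by (simp add: right_diff_distrib)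
      also have "\<dots> \<le> (\<bar>c\<bar> + 1) * ?n (\<lambda>x. f x - g x)"
        by (intro mult_right_mono) (auto simp: Lp_norm_nonneg)
      also have "\<dots> < e"
        using g(2) by (simp add: field_simps)
      finally show ?thesis
        using g cmult Lp_fun_cmult by (intro bexI[of _ "\<lambda>x. c * g x"]) auto
    qed
    then show "(\<lambda>x. c * f x) \<in> V"
      using f Lp_fun_cmult by (auto simp: V_def)
  qed
  interpret Metric_space "Lp_space (lebesgue :: 'a measure) p" "Lp_dist lebesgue p"
    by (rule Metric_space_Lp[OF p])
  \<comment> \<open>Only here does the argument pass from functions to classes, where distances
    become norms of differences by \<open>Lp_dist_class\<close>.\<close>
  have "\<exists>G\<in>Lp_class lebesgue p ` (S \<inter> ?L). G \<in> mball F r"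
    if F: "F \<in> Lp_space lebesgue p" and r: "r > 0" for F r
  proof -
    obtain f where f: "f \<in> ?L" "F = Lp_class lebesgue p f"
      using F by (rule Lp_spaceE)
    obtain g where g: "g \<in> S \<inter> ?L" "?n (\<lambda>x. f x - g x) < r"
      using V[OF f(1)] r by (auto simp: V_def)
    show ?thesis
      using f g by (intro bexI[of _ "Lp_class lebesgue p g"])
        (auto simp: Lp_dist_class Lp_class_in_space)
  qed
  then show ?thesis
    unfolding Lp_topology_def metric_closure_of by auto
qed

section \<open>ReLU networks\<close>

lemma affine_funI: "(\<And>x. a x = (\<Sum>i\<in>I. w i * x i) + b) \<Longrightarrow> affine_fun I a"
  by (auto simp: affine_fun_def)

text \<open>Layer vectors are functions on all of \<open>nat\<close>; this allows replacing one by
  another that differs beyond the width of the layer.\<close>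

lemma affine_fun_cong: "affine_fun I a \<Longrightarrow> (\<And>i. i \<in> I \<Longrightarrow> x i = y i) \<Longrightarrow> a x = a y"
  by (auto simp: affine_fun_def intro!: sum.cong)

lemma affine_fun_cmult: "affine_fun I a \<Longrightarrow> affine_fun I (\<lambda>x. c * a x)"
proof -
  assume "affine_fun I a"
  then obtain w b where "\<And>x. a x = (\<Sum>i\<in>I. w i * x i) + b"
    by (auto simp: affine_fun_def)
  then show ?thesis
    by (intro affine_funI[where w = "\<lambda>i. c * w i" and b = "c * b"])
      (simp add: distrib_left sum_distrib_left mult.assoc)
qed

lemma affine_fun_add: "affine_fun I a \<Longrightarrow> affine_fun I a' \<Longrightarrow> affine_fun I (\<lambda>x. a x + a' x)"
proof -
  assume "affine_fun I a" "affine_fun I a'"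
  then obtain w b w' b' where "\<And>x. a x = (\<Sum>i\<in>I. w i * x i) + b" "\<And>x. a' x = (\<Sum>i\<in>I. w' i * x i) + b'"
    by (auto simp: affine_fun_def)
  then show ?thesis
    by (intro affine_funI[where w = "\<lambda>i. w i + w' i" and b = "b + b'"])
      (simp add: distrib_right sum.distrib)
qed

text \<open>Padding with zero weights outside the image of \<open>h\<close>. It lets a network read
  its own block of a wider layer.\<close>

lemma affine_fun_reindex:
  assumes a: "affine_fun I a" and h: "inj_on h I" "h ` I \<subseteq> J" and J: "finite J"
  shows "affine_fun J (\<lambda>y. a (\<lambda>i. y (h i)))"
proof -
  obtain w b where w: "\<And>x. a x = (\<Sum>i\<in>I. w i * x i) + b"
    using a by (auto simp: affine_fun_def)
  define w' where "w' j = (if j \<in> h ` I then w (inv_into I h j) else 0)" for j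
  have "(\<Sum>j\<in>J. w' j * y j) = (\<Sum>i\<in>I. w i * y (h i))" for y
  proof -
    have "(\<Sum>j\<in>J. w' j * y j) = (\<Sum>j\<in>h ` I. w' j * y j)"
      using J h by (intro sum.mono_neutral_right) (auto simp: w'_def)
    also have "\<dots> = (\<Sum>i\<in>I. w i * y (h i))"
      using h by (simp add: sum.reindex w'_def)
    finally show ?thesis .
  qed
  then show ?thesis
    by (intro affine_funI[where w = w' and b = b]) (simp add: w)
qed

text \<open>The factor is absorbed into the output layer.\<close>

lemma ReLU_networks_depth3_cmult:
  assumes "f \<in> ReLU_networks_depth3"
  shows "(\<lambda>x. c * f x) \<in> ReLU_networks_depth3"
  using assms unfolding ReLU_networks_depth3_def by (force dest: affine_fun_cmult[of _ _ c])

text \<open>The two networks run in parallel: hidden layers are concatenated, with the neurons of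
  the second network shifted by \<open>m1\<close> and \<open>m2\<close>, and the output layer adds
  both results. The depth does not grow.\<close>

lemma ReLU_networks_depth3_add:
  fixes f g :: "real ^ 'n \<Rightarrow> real"
  assumes "f \<in> ReLU_networks_depth3" "g \<in> ReLU_networks_depth3"
  shows "(\<lambda>x. f x + g x) \<in> ReLU_networks_depth3"
proof -
  obtain m1 m2 :: nat and A1 :: "('n \<Rightarrow> real) \<Rightarrow> nat \<Rightarrow> real" and A2 A3
    where f: "m1 \<ge> 1" "m2 \<ge> 1" "affine_map (UNIV :: 'n set) {..<m1} A1" "affine_map {..<m1} {..<m2} A2"
      "affine_fun {..<m2} A3" "\<And>x. f x = A3 (ReLU \<circ> A2 (ReLU \<circ> A1 (($) x)))"
    using assms(1) unfolding ReLU_networks_depth3_def by auto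
  obtain k1 k2 :: nat and B1 :: "('n \<Rightarrow> real) \<Rightarrow> nat \<Rightarrow> real" and B2 B3
    where g: "k1 \<ge> 1" "k2 \<ge> 1" "affine_map (UNIV :: 'n set) {..<k1} B1" "affine_map {..<k1} {..<k2} B2"
      "affine_fun {..<k2} B3" "\<And>x. g x = B3 (ReLU \<circ> B2 (ReLU \<circ> B1 (($) x)))"
    using assms(2) unfolding ReLU_networks_depth3_def by auto
  define C1 where "C1 x j = (if j < m1 then A1 x j else B1 x (j - m1))" for x j
  define C2 where "C2 y j = (if j < m2 then A2 y j else B2 (\<lambda>i. y (m1 + i)) (j - m2))" for y j
  define C3 where "C3 z = A3 z + B3 (\<lambda>j. z (m2 + j))" for z
  have C1: "affine_map UNIV {..<m1 + k1} C1"
    unfolding affine_map_def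
  proof
    fix j assume "j \<in> {..<m1 + k1}"
    then show "affine_fun UNIV (\<lambda>x. C1 x j)"
      using f(3) g(3) by (cases "j < m1") (auto simp: affine_map_def C1_def)
  qed
  have A2: "affine_fun {..<m1 + k1} (\<lambda>y. A2 y j)" if "j < m2" for j
    using f(4) that affine_fun_reindex[of "{..<m1}" "\<lambda>y. A2 y j" id "{..<m1 + k1}"]
    by (auto simp: affine_map_def)
  have B2: "affine_fun {..<m1 + k1} (\<lambda>y. B2 (\<lambda>i. y (m1 + i)) j)" if "j < k2" for j
    using g(4) that affine_fun_reindex[of "{..<k1}" "\<lambda>y. B2 y j" "(+) m1" "{..<m1 + k1}"]
    by (simp add: affine_map_def image_subset_iff)
  have C2: "affine_map {..<m1 + k1} {..<m2 + k2} C2"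
    unfolding affine_map_def
  proof
    fix j assume "j \<in> {..<m2 + k2}"
    then show "affine_fun {..<m1 + k1} (\<lambda>y. C2 y j)"
      using A2 B2 by (cases "j < m2") (simp_all add: C2_def)
  qed
  have C3: "affine_fun {..<m2 + k2} C3"
    unfolding C3_def
    using affine_fun_reindex[OF f(5), of id "{..<m2 + k2}"]
      affine_fun_reindex[OF g(5), of "(+) m2" "{..<m2 + k2}"]
    by (intro affine_fun_add) (simp_all add: image_subset_iff)
  have "f x + g x = C3 (ReLU \<circ> C2 (ReLU \<circ> C1 (($) x)))" for x
  proof -
    \<comment> \<open>\<open>C1\<close> and \<open>A1\<close> agree only below \<open>m1\<close>, so
      the first network needs \<open>affine_fun_cong\<close>. For the second network the shifts
      cancel and the equality follows by unfolding.\<close>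
    have "A2 (ReLU \<circ> A1 (($) x)) j = C2 (ReLU \<circ> C1 (($) x)) j" if "j < m2" for j
      using f(4) that affine_fun_cong[of "{..<m1}" "\<lambda>y. A2 y j" "ReLU \<circ> A1 (($) x)" "ReLU \<circ> C1 (($) x)"]
      by (auto simp: affine_map_def C1_def C2_def)
    then have "f x = A3 (ReLU \<circ> C2 (ReLU \<circ> C1 (($) x)))"
      unfolding f(6) by (intro affine_fun_cong[OF f(5)]) auto
    moreover have "g x = B3 (\<lambda>j. (ReLU \<circ> C2 (ReLU \<circ> C1 (($) x))) (m2 + j))"
      unfolding g(6) by (simp add: C2_def C1_def comp_def)
    ultimately show ?thesis by (simp add: C3_def)
  qed
  then show ?thesis
    unfolding ReLU_networks_depth3_def using C1 C2 C3 f(1,2)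
    by (intro CollectI exI[of _ "m1 + k1"] exI[of _ "m2 + k2"] exI[of _ C1] exI[of _ C2] exI[of _ C3]) auto
qed

section \<open>Trapezoids on the line and bumps on boxes\<close>

definition trapezoid :: "real \<Rightarrow> real \<Rightarrow> real \<Rightarrow> real \<Rightarrow> real" where
  "trapezoid c a b s = c * (ReLU (s - a) - ReLU (s - (a + 1 / c)) - ReLU (s - (b - 1 / c)) + ReLU (s - b))"

text \<open>When \<open>b - a < 1 / c\<close> the trapezoid degenerates and takes negative values; the bounds below still
  hold.\<close>

lemma trapezoid_altdef:
  assumes "c > 0"
  shows "trapezoid c a b s = min 1 (max 0 (c * (s - a))) - min 1 (max 0 (c * (s - b) + 1))"
proof -
  \<comment> \<open>A scaled difference of two ReLUs is a ramp rising from 0 at \<open>u\<close> to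
    1 at \<open>u + 1 / c\<close>. The trapezoid is the ramp starting at \<open>a\<close> minus the
    ramp starting at \<open>b - 1 / c\<close>, which ends at \<open>b\<close>.\<close>
  have ramp: "c * (ReLU (s - u) - ReLU (s - (u + 1 / c))) = min 1 (max 0 (c * (s - u)))" for u
  proof -
    consider "s \<le> u" | "u \<le> s" "c * (s - u) \<le> 1" | "u \<le> s" "1 \<le> c * (s - u)"
      by linarith
    then show ?thesis
    proof cases
      case 1
      then have "c * (s - u) \<le> 0" "s - (u + 1 / c) \<le> 0"
        using assms by (auto simp: mult_le_0_iff add_increasing2)
      then show ?thesis using 1 by (simp add: ReLU_def)
    next
      case 2
      then have "s - (u + 1 / c) \<le> 0"
        using assms by (simp add: field_simps)
      then show ?thesis using 2 assms by (simp add: ReLU_def)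
    next
      case 3
      then have "0 \<le> s - (u + 1 / c)"
        using assms by (simp add: field_simps)
      then have "ReLU (s - u) - ReLU (s - (u + 1 / c)) = 1 / c"
        using 3(1) by (simp add: ReLU_def)
      then show ?thesis using 3 assms by simp
    qed
  qed
  show ?thesis
  proof -
    have eq: "c * (s - (b - 1 / c)) = c * (s - b) + 1"
      using assms by (simp add: algebra_simps)
    then have "trapezoid c a b s = c * (ReLU (s - a) - ReLU (s - (a + 1 / c)))
        - c * (ReLU (s - (b - 1 / c)) - ReLU (s - (b - 1 / c + 1 / c)))"
      by (simp add: trapezoid_def right_diff_distrib distrib_left)
    then show ?thesis
      unfolding ramp using eq by simp
  qed
qed

lemma trapezoid_le_1: "c > 0 \<Longrightarrow> trapezoid c a b s \<le> 1"
  by (simp add: trapezoid_altdef)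

text \<open>Up to \<open>a\<close> the first ramp is 0; from \<open>b\<close> on the subtracted ramp
  has reached 1, which the first never exceeds.\<close>

lemma trapezoid_nonpos: "c > 0 \<Longrightarrow> \<not> (a < s \<and> s < b) \<Longrightarrow> trapezoid c a b s \<le> 0"
  by (auto simp: trapezoid_altdef not_less min_def max_def mult_le_0_iff zero_le_mult_iff)

text \<open>The sequence is eventually constant: \<open>s\<close> lies on the plateau once
  \<open>1 / Suc k\<close> is at most both \<open>s - a\<close> and \<open>b - s\<close>.\<close>

lemma trapezoid_tendsto:
  assumes "a < s" "s < b"
  shows "(\<lambda>k. trapezoid (real (Suc k)) a b s) \<longlonglongrightarrow> 1"
proof -
  obtain K :: nat where K: "1 / (s - a) + 1 / (b - s) < real K"
    using reals_Archimedean2 by blast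
  have "trapezoid (real (Suc k)) a b s = 1" if "k \<ge> K" for k
  proof -
    have "1 / (s - a) > 0" "1 / (b - s) > 0"
      using assms by auto
    then have "1 / (s - a) \<le> real (Suc k)" "1 / (b - s) \<le> real (Suc k)"
      using K that by linarith+
    then have "1 \<le> real (Suc k) * (s - a)" "1 \<le> real (Suc k) * (b - s)"
      using assms by (simp_all add: divide_le_eq del: of_nat_Suc)
    moreover have "real (Suc k) * (s - b) = - (real (Suc k) * (b - s))"
      by (simp add: algebra_simps)
    ultimately show ?thesis
      by (simp del: of_nat_Suc add: trapezoid_altdef)
  qed
  then show ?thesis
    by (intro tendsto_eventually eventually_sequentiallyI)
qed

text \<open>A soft conjunction over the coordinates: for \<open>c > 0\<close> the summands are at
  most 1, so the sum exceeds the threshold \<open>CARD('n) - 1\<close> only if all of them are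
  positive.\<close>

definition bump :: "real \<Rightarrow> real ^ 'n \<Rightarrow> real ^ 'n \<Rightarrow> real ^ 'n \<Rightarrow> real" where
  "bump c a b x = ReLU ((\<Sum>i\<in>UNIV. trapezoid c (a $ i) (b $ i) (x $ i)) - (real CARD('n) - 1))"

text \<open>Supplies a majorant independent of \<open>c\<close>. Off the box one summand is at most
  0 and the others at most 1, so the outer ReLU returns 0.\<close>

lemma abs_bump_le:
  fixes a b x :: "real ^ 'n"
  assumes "c > 0"
  shows "\<bar>bump c a b x\<bar> \<le> indicator (box a b) x"
proof (cases "x \<in> box a b")
  case True
  have "(\<Sum>i\<in>UNIV. trapezoid c (a $ i) (b $ i) (x $ i)) \<le> (\<Sum>i\<in>(UNIV :: 'n set). 1)"
    using assms by (intro sum_mono trapezoid_le_1)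
  then show ?thesis
    using True by (auto simp: bump_def ReLU_def)
next
  case False
  then obtain j where j: "\<not> (a $ j < x $ j \<and> x $ j < b $ j)"
    by (auto simp: mem_box_cart)
  have "(\<Sum>i\<in>UNIV. trapezoid c (a $ i) (b $ i) (x $ i)) \<le> (\<Sum>i\<in>(UNIV :: 'n set). if i = j then 0 else 1)"
    using assms j trapezoid_le_1 trapezoid_nonpos by (intro sum_mono) auto
  also have "\<dots> = real CARD('n) - 1"
    by (simp add: sum.If_cases Compl_eq_Diff_UNIV card_Diff_subset of_nat_diff Suc_leI)
  finally show ?thesis
    using False by (simp add: bump_def ReLU_def)
qed

lemma bump_tendsto:
  fixes a b x :: "real ^ 'n"
  shows "(\<lambda>k. bump (real (Suc k)) a b x) \<longlonglongrightarrow> indicator (box a b) x"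
proof (cases "x \<in> box a b")
  case True
  have "(\<lambda>k. bump (real (Suc k)) a b x) \<longlonglongrightarrow> max ((\<Sum>i\<in>(UNIV :: 'n set). 1) - (real CARD('n) - 1)) 0"
    unfolding bump_def ReLU_def using True
    by (intro tendsto_intros tendsto_max trapezoid_tendsto) (auto simp: mem_box_cart)
  then show ?thesis using True by simp
next
  case False
  then have "bump (real (Suc k)) a b x = 0" for k
    using abs_bump_le[of "real (Suc k)" a b x] by simp
  then show ?thesis using False by simp
qed

lemma bump_measurable: "bump c a b \<in> borel_measurable lebesgue"
proof -
  have "continuous_on UNIV (bump c a b)"
    unfolding bump_def ReLU_def trapezoid_def by (intro continuous_intros)
  then show ?thesis
    by (intro measurable_completion) (simp add: borel_measurable_continuous_onI)
qed

text \<open>The first hidden layer has one neuron per coordinate and breakpoint, four for each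
  coordinate; the second has a single neuron, the outer ReLU of \<open>bump\<close>, and the output
  copies it.\<close>

lemma bump_network:
  fixes a b :: "real ^ 'n"
  shows "bump c a b \<in> ReLU_networks_depth3"
proof -
  define J where "J = (UNIV :: 'n set) \<times> {..<4::nat}"
  \<comment> \<open>\<open>t i\<close> lists the breakpoints of the trapezoid in coordinate
    \<open>i\<close>, and \<open>u\<close> the matching signed coefficients.\<close>
  define t where "t i = (!) [a $ i, a $ i + 1 / c, b $ i - 1 / c, b $ i]" for i
  define u where "u = (!) [c, - c, - c, c]"
  have "finite J" by (simp add: J_def)
  then obtain h where h: "bij_betw h {..<card J} J"
    using ex_bij_betw_nat_finite[of J] by (auto simp: atLeast0LessThan)
  define A1 where "A1 x j = (case h j of (i, r) \<Rightarrow> x i - t i r)" for x :: "'n \<Rightarrow> real" and j :: nat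
  \<comment> \<open>The bias is the negated threshold of \<open>bump\<close>.\<close>
  define A2 where "A2 y l = (\<Sum>j<card J. u (snd (h j)) * y j) + (1 - real CARD('n))"
    for y :: "nat \<Rightarrow> real" and l :: nat
  define A3 where "A3 z = z 0" for z :: "nat \<Rightarrow> real"
  have "affine_fun UNIV (\<lambda>x. A1 x j)" for j
  proof (rule affine_funI)
    show "A1 x j = (\<Sum>i\<in>UNIV. (if i = fst (h j) then 1 else 0) * x i) + - t (fst (h j)) (snd (h j))" for x
      by (simp add: A1_def split_beta if_distrib[of "\<lambda>v. v * _"] cong: if_cong)
  qed
  then have 1: "affine_map UNIV {..<card J} A1"
    by (simp add: affine_map_def)
  have 2: "affine_map {..<card J} {..<1::nat} A2"
    unfolding affine_map_def A2_def by (intro ballI affine_funI) auto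
  have 3: "affine_fun {..<1} A3"
    by (rule affine_funI[where w = "\<lambda>_. 1" and b = 0]) (simp add: A3_def)
  have "bump c a b x = A3 (ReLU \<circ> A2 (ReLU \<circ> A1 (($) x)))" for x
  proof -
    have "(\<Sum>j<card J. u (snd (h j)) * ReLU (A1 (($) x) j))
        = (\<Sum>q\<in>J. u (snd q) * ReLU (x $ fst q - t (fst q) (snd q)))"
      unfolding A1_def split_beta
      by (rule sum.reindex_bij_betw[OF h, where g = "\<lambda>q. u (snd q) * ReLU (x $ fst q - t (fst q) (snd q))"])
    also have "\<dots> = (\<Sum>i\<in>UNIV. \<Sum>r<4. u r * ReLU (x $ i - t i r))"
      by (simp add: J_def sum.cartesian_product split_beta)
    also have "\<dots> = (\<Sum>i\<in>UNIV. trapezoid c (a $ i) (b $ i) (x $ i))"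
      by (simp add: u_def t_def trapezoid_def eval_nat_numeral algebra_simps)
    finally show ?thesis
      by (simp add: bump_def A2_def A3_def comp_def algebra_simps)
  qed
  moreover have "card J \<ge> 1"
    by (simp add: J_def card_cartesian_product Suc_leI)
  ultimately show ?thesis
    unfolding ReLU_networks_depth3_def using 1 2 3
    by (intro CollectI exI[of _ "card J"] exI[of _ "1::nat"] exI[of _ A1] exI[of _ A2] exI[of _ A3]) auto
qed

theorem theorem5p4:
  fixes p :: real
  assumes "1 \<le> p"
  shows "Lp_topology (lebesgue :: (real ^ 'n) measure) p closure_of
      (Lp_class lebesgue p ` (ReLU_networks_depth3 \<inter> Lp_fun lebesgue p))
    = Lp_space lebesgue p"
proof (rule Lp_closure_of_lebesgue[OF assms ReLU_networks_depth3_add ReLU_networks_depth3_cmult])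
  fix a b :: "real ^ 'n"
  \<comment> \<open>The steepness \<open>Suc k\<close> is positive already at \<open>k = 0\<close>,
    as \<open>abs_bump_le\<close> requires.\<close>
  show "\<exists>s. (\<forall>k. s k \<in> ReLU_networks_depth3) \<and> (\<forall>k. s k \<in> borel_measurable lebesgue) \<and>
      (\<forall>k x. \<bar>s k x\<bar> \<le> indicator (box a b) x) \<and> (\<forall>x. (\<lambda>k. s k x) \<longlonglongrightarrow> indicator (box a b) x)"
    by (intro exI[of _ "\<lambda>k. bump (real (Suc k)) a b"] conjI allI bump_network bump_measurable
        abs_bump_le bump_tendsto) auto
qed

end
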